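(* Let $d\ge 1$, let $h:\mathbb{R}_+\times\mathbb{R}^d\to\mathbb{R}$ be measurable, and suppose that the shot noise series $I=\sum_{i=1}^{+\infty}h(T_i,\Delta_i)$ is well defined. Suppose that $$\big((\lambda_{\mathbb{R}_+}\otimes\sigma)h^{-1}\big)_{|\mathbb{R}\setminus\{0\}}\ll\lambda .$$ Then the law of $I$ is absolutely continuous with respect to $\lambda$ on $\mathbb{R}\setminus\{0\}$, with possibly an atom at zero; that is, $\mathbb{P}(I\in A)=0$ for every Borel set $A\subset\mathbb{R}\setminus\{0\}$ with $\lambda(A)=0$.
   Context: $(\Delta_i)_{i\ge1}$ is an i.i.d. sequence of random vectors in $\mathbb{R}^d$ with common law $\sigma$, where $\sigma(\{0\})=0$. Independently, $(T_i)_{i\ge1}$ is the sequence of partial sums of i.i.d. exponential random variables with parameter $\alpha>0$. The series $I$ is well defined means that it converges almost surely; this is ensured by the conditions $\int_0^{+\infty}\int_{\mathbb{R}^d\setminus\{0\}}(|h(t,x)|^2\wedge1)\,dt\,\sigma(dx)<+\infty$ and existence of the (finite) limit $\lim_{s\to+\infty}\int_0^s\int_{\mathbb{R}^d\setminus\{0\}}h(t,x)\mathbf{1}_{|h(t,x)|\le1}\,dt\,\sigma(dx)$. $\lambda$ is Lebesgue measure on $\mathbb{R}$, and $\lambda_{\mathbb{R}_+}$ is its restriction to $\mathbb{R}_+$. $(\lambda_{\mathbb{R}_+}\otimes\sigma)h^{-1}$ is the image (pushforward) of $\lambda_{\mathbb{R}_+}\otimes\sigma$ under $h$, and $\mu_{|\mathbb{R}\setminus\{0\}}$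 is the restriction of a measure $\mu$ to $\mathbb{R}\setminus\{0\}$. $\mu_1\ll\mu_2$ denotes absolute continuity of $\mu_1$ with respect to $\mu_2$. *)

theory Defs
  imports "HOL-Probability.Probability"
begin

end

theory Submission
  imports Defs
begin

text \<open>
  If the sum lies in a set \<open>A\<close> not containing \<open>0\<close>, then some term \<open>h (T i, \<Delta> i)\<close> is nonzero, so it
  suffices to bound the countably many events "term \<open>i\<close> is nonzero and the sum lies in \<open>A\<close>". Given
  all the other arrival times and all the other marks, the sum is \<open>h (T i, \<Delta> i) + r\<close> with \<open>r\<close> fixed,
  and the law of \<open>(T i, \<Delta> i)\<close> is absolutely continuous with respect to \<open>\<lambda> \<otimes> \<sigma>\<close>. If \<open>A\<close> is Lebesgue
  null, so is \<open>(A - r) - {0}\<close>, and the hypothesis on the image of \<open>\<lambda> \<otimes> \<sigma>\<close> under \<open>h\<close> applies.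
\<close>

section \<open>Resampling a coordinate and shearing the plane\<close>

text \<open>Overwriting coordinate \<open>i\<close> by an independent draw from \<open>N i\<close>
  preserves the product law. This gives access to the conditional law of one coordinate given all
  the others without splitting the index set.\<close>

lemma nn_integral_PiM_resample:
  fixes N :: "'i \<Rightarrow> 'a measure"
  assumes N: "\<And>i. prob_space (N i)" and f [measurable]: "f \<in> borel_measurable (PiM UNIV N)"
  shows "(\<integral>\<^sup>+X. f X \<partial>PiM UNIV N) = (\<integral>\<^sup>+X. \<integral>\<^sup>+x. f (X(i := x)) \<partial>N i \<partial>PiM UNIV N)"
proof -
  interpret Ni: prob_space "N i" by (rule N)
  interpret P: prob_space "PiM UNIV N" by (intro prob_space_PiM N)
  interpret pair_sigma_finite "N i" "PiM UNIV N" ..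
  have upd [measurable]: "(\<lambda>(x, X). X(i := x)) \<in> N i \<Otimes>\<^sub>M PiM UNIV N \<rightarrow>\<^sub>M PiM UNIV N"
    unfolding split_beta by (rule measurable_fun_upd[where J = UNIV]) auto
  have "PiM UNIV N = distr (N i \<Otimes>\<^sub>M PiM UNIV N) (PiM UNIV N) (\<lambda>(x, X). X(i := x))"
    using distr_pair_PiM_eq_PiM[of UNIV N i] N by simp
  then have "(\<integral>\<^sup>+X. f X \<partial>PiM UNIV N) =
      (\<integral>\<^sup>+X. f X \<partial>distr (N i \<Otimes>\<^sub>M PiM UNIV N) (PiM UNIV N) (\<lambda>(x, X). X(i := x)))"
    by simp
  also have "\<dots> = (\<integral>\<^sup>+z. f (case z of (x, X) \<Rightarrow> X(i := x)) \<partial>(N i \<Otimes>\<^sub>M PiM UNIV N))"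
    by (rule nn_integral_distr) measurable
  also have "\<dots> = (\<integral>\<^sup>+X. \<integral>\<^sup>+x. f (X(i := x)) \<partial>N i \<partial>PiM UNIV N)"
    by (subst nn_integral_snd[symmetric]) (auto simp: split_beta')
  finally show ?thesis .
qed

lemma nn_integral_0I: "AE x in M. f x = 0 \<Longrightarrow> (\<integral>\<^sup>+x. f x \<partial>M) = 0"
  using nn_integral_cong_AE[of f "\<lambda>_. 0" M] by simp

text \<open>For fixed \<open>x\<close>, passing from \<open>y\<close> to \<open>w = x + y\<close> is
  a translation and preserves Lebesgue measure. Both quantifiers are exchanged so that
  \<open>x\<close> is fixed first, and exchanged back afterwards. Below, \<open>x\<close> and
  \<open>y\<close> are two consecutive gaps and \<open>w\<close> is their sum.\<close>

lemma AE_lborel_shear: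
  fixes P :: "real \<Rightarrow> real \<Rightarrow> bool"
  assumes [measurable]: "Measurable.pred (borel \<Otimes>\<^sub>M borel) (\<lambda>(x, y). P x y)"
    and shear: "AE w in lborel. AE x in lborel. P x (w - x)"
  shows "AE y in lborel. AE x in lborel. P x y"
proof -
  have "(\<lambda>z. (fst z, snd z - fst z)) \<in> borel \<Otimes>\<^sub>M borel \<rightarrow>\<^sub>M (borel \<Otimes>\<^sub>M borel :: (real \<times> real) measure)"
    by measurable
  from measurable_compose[OF this assms(1)]
  have "{z \<in> space (lborel \<Otimes>\<^sub>M lborel). P (fst z) (snd z - fst z)} \<in> sets (lborel \<Otimes>\<^sub>M lborel)"
    by (simp add: pred_def space_pair_measure cong: sets_pair_measure_cong)
  note shear_commute = lborel_pair.AE_commute[OF this]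
  have "AE x in lborel. AE w in lborel. P x (w - x)"
    using shear by (simp add: shear_commute)
  then have "AE x in lborel. AE y in lborel. P x y"
  proof eventually_elim
    case (elim x)
    then have "AE w in distr lborel borel ((+) x). P x (w - x)"
      unfolding lborel_distr_plus .
    then show ?case by (rule AE_distrD[rotated, THEN AE_mp]) auto
  qed
  then show ?thesis
    by (rule lborel_pair.AE_commute[THEN iffD1, rotated])
      (use assms(1) in \<open>simp add: pred_def split_beta space_pair_measure cong: sets_pair_measure_cong\<close>)
qed

section \<open>The series as a function of gaps and marks, and its measurability\<close>

lemma measurable_fun_upd_apply [measurable]:
  assumes "(\<lambda>z. f z n) \<in> measurable Q R" "g \<in> measurable Q R"
  shows "(\<lambda>z. ((f z)(i := g z)) n) \<in> measurable Q R"
  using assms by (cases "n = i") simp_all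

text \<open>\<open>shot\<close> takes the inter-arrival times \<open>e\<close>, not the arrival times, as its argument.\<close>

definition shot :: "(real \<times> 'b \<Rightarrow> real) \<Rightarrow> (nat \<Rightarrow> real) \<Rightarrow> (nat \<Rightarrow> 'b) \<Rightarrow> nat \<Rightarrow> real" where
  "shot h e d n = h (\<Sum>j\<le>n. e j, d n)"

text \<open>The bad event for index \<open>i\<close>. Summability belongs to it because
  \<open>suminf\<close> carries no information on a divergent series.\<close>

definition hits :: "(real \<times> 'b \<Rightarrow> real) \<Rightarrow> real set \<Rightarrow> nat \<Rightarrow> (nat \<Rightarrow> real) \<Rightarrow> (nat \<Rightarrow> 'b) \<Rightarrow> bool" where
  "hits h A i e d \<longleftrightarrow> summable (shot h e d) \<and> shot h e d i \<noteq> 0 \<and> suminf (shot h e d) \<in> A"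

lemma measurable_hits:
  fixes h :: "real \<times> 'b::topological_space \<Rightarrow> real"
  assumes [measurable]: "h \<in> borel_measurable (borel \<Otimes>\<^sub>M borel)" "A \<in> sets borel"
    and e [measurable]: "\<And>n. (\<lambda>z. e z n) \<in> borel_measurable Q"
    and d [measurable]: "\<And>n. (\<lambda>z. d z n) \<in> borel_measurable Q"
  shows "Measurable.pred Q (\<lambda>z. hits h A i (e z) (d z))"
proof -
  have [measurable]: "(\<lambda>z. shot h (e z) (d z) n) \<in> borel_measurable Q" for n
  proof -
    have "(\<lambda>z. (\<Sum>j\<le>n. e z j, d z n)) \<in> Q \<rightarrow>\<^sub>M borel \<Otimes>\<^sub>M borel"
      by (intro measurable_Pair borel_measurable_sum e d)
    from measurable_compose[OF this assms(1)] show ?thesis by (simp add: shot_def)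
  qed
  show ?thesis
  proof -
    \<comment> \<open>Convergence is expressed as the Cauchy property of the partial sums, whose
      measurability follows from that of each partial sum.\<close>
    have "(\<lambda>z. sum (shot h (e z) (d z)) {..<n}) \<in> borel_measurable Q" for n
      by (rule borel_measurable_sum) simp
    note cauchy = sets_Collect_Cauchy[OF this, folded pred_def]
    show ?thesis
      unfolding hits_def summable_iff_convergent Cauchy_convergent_iff[symmetric]
      by (intro pred_intros_logic cauchy) simp_all
  qed
qed

section \<open>Displacing one arrival while all others stay fixed\<close>

text \<open>For \<open>n < i\<close> neither updated gap enters the sum; for \<open>n > i\<close>
  both do, and they contribute \<open>x + (w - x) = 0 + w\<close>. So no arrival other than the
  \<open>i\<close>-th depends on \<open>x\<close>.\<close>

lemma sum_fun_upd_shear: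
  fixes e :: "nat \<Rightarrow> real"
  assumes "n \<noteq> i"
  shows "(\<Sum>j\<le>n. (e(Suc i := w - x, i := x)) j) = (\<Sum>j\<le>n. (e(Suc i := w, i := 0)) j)"
proof (cases "n < i")
  case True
  then show ?thesis by (intro sum.cong) auto
next
  case False
  with assms have *: "{..n} = insert i (insert (Suc i) ({..n} - {i, Suc i}))" by auto
  have split: "sum f {..n} = f i + (f (Suc i) + sum f ({..n} - {i, Suc i}))" for f :: "nat \<Rightarrow> real"
    by (rule trans[OF arg_cong[OF *, of "sum f"]]) simp
  have "sum (e(Suc i := w - x, i := x)) ({..n} - {i, Suc i}) = sum (e(Suc i := w, i := 0)) ({..n} - {i, Suc i})"
    by (intro sum.cong) auto
  then show ?thesis
    unfolding split by simp
qed

text \<open>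
  Moving the arrival \<open>i\<close> while keeping the arrival \<open>Suc i\<close>, that is \<open>w = e i + e (Suc i)\<close>, fixed
  changes only the \<open>i\<close>-th term of the series.
\<close>

lemma AE_not_hits_update:
  fixes h :: "real \<times> 'b::topological_space \<Rightarrow> real" and S :: "'b measure"
  assumes null: "\<And>C. C \<in> null_sets lborel \<Longrightarrow> 0 \<notin> C \<Longrightarrow> AE t in lborel. AE x in S. h (t, x) \<notin> C"
    and A: "A \<in> null_sets lborel"
  shows "AE x in lborel. AE \<delta> in S. \<not> hits h A i (e(Suc i := w - x, i := x)) (d(i := \<delta>))"
proof -
  define s where "s = (\<Sum>j<i. e j)"
  \<comment> \<open>The sum of the other terms, free of \<open>x\<close> and
    \<open>\<delta>\<close>. If these terms do not converge, \<open>r\<close> is arbitrary, which is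
    harmless because \<open>hits\<close> is then false.\<close>
  define r where
    "r = (\<Sum>n. if n = i then 0 else h (\<Sum>j\<le>n. (e(Suc i := w, i := 0)) j, d n))"
  have i_sum: "(\<Sum>j\<le>i. (e(Suc i := w - x, i := x)) j) = s + x" for x
  proof -
    have "(\<Sum>j<i. (e(Suc i := w - x, i := x)) j) = s"
      unfolding s_def by (intro sum.cong) auto
    then show ?thesis
      unfolding lessThan_Suc_atMost[symmetric] by (simp del: fun_upd_apply) simp
  qed
  \<comment> \<open>The translate of \<open>A\<close> may contain \<open>0\<close>, about which
    \<open>null\<close> says nothing; the clause in \<open>hits\<close> that term \<open>i\<close>
    is nonzero allows \<open>0\<close> to be removed.\<close>
  have decomp: "h (s + x, \<delta>) \<in> {u. u - (- r) \<in> A} - {0}"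
    if "hits h A i (e(Suc i := w - x, i := x)) (d(i := \<delta>))" for x \<delta>
  proof -
    let ?f = "shot h (e(Suc i := w - x, i := x)) (d(i := \<delta>))"
    from that have f: "summable ?f" "?f i \<noteq> 0" "suminf ?f \<in> A" by (auto simp: hits_def)
    have fi: "?f i = h (s + x, \<delta>)" using i_sum[of x] by (simp add: shot_def)
    have "(\<lambda>n. ?f n - (if n = i then ?f n else 0)) sums (suminf ?f - ?f i)"
      by (intro sums_diff summable_sums f sums_single)
    also have "(\<lambda>n. ?f n - (if n = i then ?f n else 0)) =
        (\<lambda>n. if n = i then 0 else h (\<Sum>j\<le>n. (e(Suc i := w, i := 0)) j, d n))"
      by (rule ext) (simp add: shot_def sum_fun_upd_shear del: fun_upd_apply sum.atMost_Suc, simp)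
    finally have "r = suminf ?f - ?f i" unfolding r_def by (rule sums_unique[symmetric])
    with f fi show ?thesis by simp
  qed
  have "{u. u - (- r) \<in> A} - {0} \<in> null_sets lborel"
    using null_sets_translation[OF A, of "- r"] by (rule null_set_Diff) simp
  then have "AE t in lborel. AE x in S. h (t, x) \<notin> {u. u - (- r) \<in> A} - {0}"
    by (rule null) simp
  then have "AE t in distr lborel borel ((+) s). AE x in S. h (t, x) \<notin> {u. u - (- r) \<in> A} - {0}"
    unfolding lborel_distr_plus .
  then have "AE x in lborel. AE \<delta> in S. h (s + x, \<delta>) \<notin> {u. u - (- r) \<in> A} - {0}"
    by (rule AE_distrD[rotated]) simp
  then show ?thesis
    using decomp by (auto elim!: eventually_mono)
qed

section \<open>Nullity of the bad events under the product law\<close>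

text \<open>By Fubini, three coordinates are resampled: mark \<open>i\<close> and the gaps
  \<open>i\<close> and \<open>Suc i\<close>. The second gap is needed to compensate the first, so
  that later arrivals do not move. With everything else frozen, the shear reduces the claim to the
  displacement of a single arrival.\<close>

lemma AE_not_hits:
  fixes h :: "real \<times> 'b::topological_space \<Rightarrow> real" and S :: "'b measure"
  assumes h [measurable]: "h \<in> borel_measurable (borel \<Otimes>\<^sub>M borel)"
    and S: "prob_space S" "sets S = sets borel"
    and f: "f \<in> borel_measurable borel" "prob_space (density lborel f)"
    and null: "\<And>C. C \<in> null_sets lborel \<Longrightarrow> 0 \<notin> C \<Longrightarrow> AE t in lborel. AE x in S. h (t, x) \<notin> C"
    and A: "A \<in> null_sets lborel"
  shows "AE (e, d) in PiM UNIV (\<lambda>_::nat. density lborel f) \<Otimes>\<^sub>M PiM UNIV (\<lambda>_::nat. S).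
    \<not> hits h A i e d"
proof -
  define N where "N = density lborel f"
  let ?K = "PiM UNIV (\<lambda>_::nat. N)" and ?L = "PiM UNIV (\<lambda>_::nat. S)"
  note S(2) [measurable_cong]
  have sets_N [measurable_cong]: "sets N = sets borel" by (simp add: N_def)
  interpret S: prob_space S by fact
  interpret N: prob_space N using f(2) by (simp add: N_def)
  interpret K: prob_space ?K by (intro prob_space_PiM N.prob_space_axioms)
  interpret L: prob_space ?L by (intro prob_space_PiM S.prob_space_axioms)
  interpret KL: pair_sigma_finite ?K ?L ..
  have A' [measurable]: "A \<in> sets borel" using A by auto
  define b :: "(nat \<Rightarrow> real) \<Rightarrow> (nat \<Rightarrow> 'b) \<Rightarrow> ennreal"
    where "b e d = (if hits h A i e d then 1 else 0)" for e d
  have [measurable]: "(\<lambda>z. b (e z) (d z)) \<in> borel_measurable Q"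
    if "\<And>n. (\<lambda>z. e z n) \<in> borel_measurable Q" "\<And>n. (\<lambda>z. d z n) \<in> borel_measurable Q"
    for e d and Q :: "'q measure"
    unfolding b_def using measurable_hits[OF h A' that] by measurable
  have zero: "(\<integral>\<^sup>+y. \<integral>\<^sup>+x. \<integral>\<^sup>+\<delta>. b (e(Suc i := y, i := x)) (d(i := \<delta>)) \<partial>S \<partial>N \<partial>N) = 0" for e d
  proof -
    define u where "u = (\<lambda>x y. \<integral>\<^sup>+\<delta>. b (e(Suc i := y, i := x)) (d(i := \<delta>)) \<partial>S)"
    have u_eq: "u x y = 0 \<longleftrightarrow> (AE \<delta> in S. \<not> hits h A i (e(Suc i := y, i := x)) (d(i := \<delta>)))" for x y
    proof -
      have "(\<lambda>\<delta>. b (e(Suc i := y, i := x)) (d(i := \<delta>))) \<in> borel_measurable S" by measurable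
      then show ?thesis unfolding u_def by (simp add: nn_integral_0_iff_AE) (simp add: b_def)
    qed
    have "AE y in lborel. AE x in lborel. u x y = 0"
    proof (rule AE_lborel_shear)
      have "(\<lambda>(x, y). u x y) \<in> borel_measurable (borel \<Otimes>\<^sub>M borel)"
        unfolding u_def split_beta by (rule S.borel_measurable_nn_integral) measurable
      then show "Measurable.pred (borel \<Otimes>\<^sub>M borel) (\<lambda>(x, y). u x y = 0)"
        unfolding split_beta by measurable
      show "AE w in lborel. AE x in lborel. u x (w - x) = 0"
        unfolding u_eq by (intro AE_I2 AE_not_hits_update[OF null A])
    qed
    \<comment> \<open>Only the absolute continuity of the gap law is used here, not the form of its
      density.\<close>
    then have "AE y in N. AE x in N. u x y = 0"
      unfolding N_def using f(1) by (auto simp: AE_density elim: eventually_mono)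
    then have "(\<integral>\<^sup>+y. \<integral>\<^sup>+x. u x y \<partial>N \<partial>N) = 0"
      by (intro nn_integral_0I) (auto elim!: eventually_mono intro: nn_integral_0I)
    then show ?thesis by (simp only: u_def)
  qed
  let ?X = "{z \<in> space (?K \<Otimes>\<^sub>M ?L). hits h A i (fst z) (snd z)}"
  have X [measurable]: "?X \<in> sets (?K \<Otimes>\<^sub>M ?L)"
    unfolding pred_def[symmetric] by (rule measurable_hits[OF h A']) measurable
  have "emeasure (?K \<Otimes>\<^sub>M ?L) ?X = (\<integral>\<^sup>+e. \<integral>\<^sup>+d. b e d \<partial>?L \<partial>?K)"
    unfolding L.emeasure_pair_measure[OF X]
    by (intro nn_integral_cong) (auto simp: b_def indicator_def space_pair_measure)
  also have "\<dots> = (\<integral>\<^sup>+e. \<integral>\<^sup>+d. \<integral>\<^sup>+\<delta>. b e (d(i := \<delta>)) \<partial>S \<partial>?L \<partial>?K)"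
    by (intro nn_integral_cong nn_integral_PiM_resample S.prob_space_axioms) measurable
  \<comment> \<open>The gap sequence is moved inside, so that its coordinates can be resampled with
    the marks held fixed.\<close>
  also have "\<dots> = (\<integral>\<^sup>+d. \<integral>\<^sup>+e. \<integral>\<^sup>+\<delta>. b e (d(i := \<delta>)) \<partial>S \<partial>?K \<partial>?L)"
    by (rule KL.Fubini'[symmetric], unfold split_beta, rule S.borel_measurable_nn_integral) measurable
  also have "\<dots> = (\<integral>\<^sup>+d. \<integral>\<^sup>+e. \<integral>\<^sup>+x. \<integral>\<^sup>+\<delta>. b (e(i := x)) (d(i := \<delta>)) \<partial>S \<partial>N \<partial>?K \<partial>?L)"
    by (intro nn_integral_cong nn_integral_PiM_resample[where N = "\<lambda>_. N"] N.prob_space_axioms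
        S.borel_measurable_nn_integral, unfold split_beta) measurable
  also have "\<dots> = (\<integral>\<^sup>+d. \<integral>\<^sup>+e. \<integral>\<^sup>+y. \<integral>\<^sup>+x. \<integral>\<^sup>+\<delta>. b (e(Suc i := y, i := x)) (d(i := \<delta>)) \<partial>S \<partial>N \<partial>N \<partial>?K \<partial>?L)"
    by (intro nn_integral_cong nn_integral_PiM_resample[where N = "\<lambda>_. N"] N.prob_space_axioms
        S.borel_measurable_nn_integral N.borel_measurable_nn_integral, unfold split_beta,
        intro S.borel_measurable_nn_integral, unfold split_beta) measurable
  also have "\<dots> = 0" by (simp add: zero)
  finally have "emeasure (?K \<Otimes>\<^sub>M ?L) ?X = 0" .
  with X show ?thesis
    unfolding N_def[symmetric] by (intro AE_I[where N = ?X]) auto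
qed

section \<open>Joint laws from independent families of events\<close>

text \<open>Independence gives the product formula on rectangles, which determine the joint law. The
  families need only contain the preimages under \<open>X\<close> and \<open>Y\<close>, so
  independence stated for the arrival times can serve for the gaps.\<close>

lemma (in prob_space) distr_pair_indep_set:
  assumes "indep_set \<A> \<B>"
    and [measurable]: "X \<in> measurable M S" "Y \<in> measurable M R"
    and X: "\<And>A. A \<in> sets S \<Longrightarrow> X -` A \<inter> space M \<in> \<A>"
    and Y: "\<And>B. B \<in> sets R \<Longrightarrow> Y -` B \<inter> space M \<in> \<B>"
  shows "distr M (S \<Otimes>\<^sub>M R) (\<lambda>\<omega>. (X \<omega>, Y \<omega>)) = distr M S X \<Otimes>\<^sub>M distr M R Y"
proof (rule pair_measure_eqI[symmetric])
  interpret X: prob_space "distr M S X" by (rule prob_space_distr) simp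
  interpret Y: prob_space "distr M R Y" by (rule prob_space_distr) simp
  show "sigma_finite_measure (distr M S X)" "sigma_finite_measure (distr M R Y)" ..
  show "sets (distr M S X \<Otimes>\<^sub>M distr M R Y) = sets (distr M (S \<Otimes>\<^sub>M R) (\<lambda>\<omega>. (X \<omega>, Y \<omega>)))"
    by (simp cong: sets_pair_measure_cong)
  fix A B assume "A \<in> sets (distr M S X)" "B \<in> sets (distr M R Y)"
  then have [measurable]: "A \<in> sets S" "B \<in> sets R" by auto
  have "(\<lambda>\<omega>. (X \<omega>, Y \<omega>)) -` (A \<times> B) \<inter> space M = (X -` A \<inter> space M) \<inter> (Y -` B \<inter> space M)"
    by auto
  then show "emeasure (distr M S X) A * emeasure (distr M R Y) B =
      emeasure (distr M (S \<Otimes>\<^sub>M R) (\<lambda>\<omega>. (X \<omega>, Y \<omega>))) (A \<times> B)"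
    using indep_setD[OF assms(1) X Y, of A B]
    by (simp add: emeasure_distr emeasure_eq_measure ennreal_mult)
qed

section \<open>Transfer from the product space of gaps and marks to the law of the series\<close>

theorem proposition2p1:
  fixes M :: "'a measure"
    and \<sigma> :: "(real ^ 'd) measure"
    and \<Delta> :: "nat \<Rightarrow> 'a \<Rightarrow> real ^ 'd"
    and E T :: "nat \<Rightarrow> 'a \<Rightarrow> real"
    and \<alpha> :: real
    and h :: "real \<times> (real ^ 'd) \<Rightarrow> real"
    and I :: "'a \<Rightarrow> real"
  assumes "prob_space M"
    and "prob_space.indep_vars M (\<lambda>_. borel) \<Delta> UNIV"
    and "\<And>i. distr M borel (\<Delta> i) = \<sigma>"
    and "emeasure \<sigma> {0} = 0"
    and "\<alpha> > 0"
    and "prob_space.indep_vars M (\<lambda>_. borel) E UNIV"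
    and "\<And>i. distributed M lborel (E i) (exponential_density \<alpha>)"
    and "\<And>i \<omega>. T i \<omega> = (\<Sum>j\<le>i. E j \<omega>)"
    and "prob_space.indep_set M
           (sets (vimage_algebra (space M) (\<lambda>\<omega> i. T i \<omega>) (Pi\<^sub>M UNIV (\<lambda>_. borel))))
           (sets (vimage_algebra (space M) (\<lambda>\<omega> i. \<Delta> i \<omega>) (Pi\<^sub>M UNIV (\<lambda>_. borel))))"
    and "h \<in> borel_measurable (restrict_space borel {0..} \<Otimes>\<^sub>M borel)"
    and "I \<in> borel_measurable M"
    and "AE \<omega> in M. (\<lambda>i. h (T i \<omega>, \<Delta> i \<omega>)) sums I \<omega>"
    and "absolutely_continuous
           (restrict_space lborel (- {0}))
           (restrict_space (distr (restrict_space lborel {0..} \<Otimes>\<^sub>M \<sigma>) borel h) (- {0}))"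
  shows "absolutely_continuous
           (restrict_space lborel (- {0}))
           (restrict_space (distr M borel I) (- {0})) \<and>
         (\<forall>A \<in> sets borel. A \<subseteq> - {0} \<longrightarrow> emeasure lborel A = 0 \<longrightarrow>
           measure M {\<omega> \<in> space M. I \<omega> \<in> A} = 0)"
proof -
  interpret prob_space M by fact
  \<comment> \<open>Translations and shears act on the whole line, whereas \<open>h\<close> is
    controlled only at nonnegative times. The default value \<open>0\<close> creates no mass in sets
    that avoid \<open>0\<close>.\<close>
  define h0 where "h0 z = (if fst z \<in> {0..} then h z else 0)" for z
  define N where "N = density lborel (exponential_density \<alpha>)"
  have E [measurable]: "E i \<in> borel_measurable M" for i
    using distributed_measurable[OF assms(7)] by simp
  have \<Delta> [measurable]: "\<Delta> i \<in> borel_measurable M" for i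
    using assms(2) by (simp add: indep_vars_def)
  have T [measurable]: "T i \<in> borel_measurable M" for i
    unfolding assms(8) by measurable
  have \<sigma>: "prob_space \<sigma>" "sets \<sigma> = sets borel"
    using prob_space_distr[OF \<Delta>, of 0] sets_distr[of M borel "\<Delta> 0"] unfolding assms(3) by auto
  interpret \<sigma>: prob_space \<sigma> by (rule \<sigma>)
  have distr_E: "distr M borel (E i) = N" for i
    using distributed_distr_eq_density[OF assms(7), of i] by (simp add: N_def cong: distr_cong)
  have N: "prob_space N"
    using prob_space_distr[OF E, of 0] unfolding distr_E .

  have seq_law: "distr M (PiM UNIV (\<lambda>_. borel)) (\<lambda>\<omega> i. X i \<omega>) = PiM UNIV (\<lambda>_. Q)"
    if "indep_vars (\<lambda>_. borel) X UNIV" "\<And>i. distr M borel (X i) = Q"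
    for X :: "nat \<Rightarrow> 'a \<Rightarrow> 'c::topological_space" and Q
    using indep_vars_iff_distr_eq_PiM'[where I = UNIV and M' = "\<lambda>_. borel" and X = X] that
    by (simp add: indep_vars_def restrict_UNIV)
  let ?P = "PiM UNIV (\<lambda>_::nat. borel :: real measure)"
  let ?Q = "PiM UNIV (\<lambda>_::nat. borel :: (real ^ 'd) measure)"
  have rv [measurable]: "(\<lambda>\<omega> i. E i \<omega>) \<in> M \<rightarrow>\<^sub>M ?P" "(\<lambda>\<omega> i. T i \<omega>) \<in> M \<rightarrow>\<^sub>M ?P"
      "(\<lambda>\<omega> i. \<Delta> i \<omega>) \<in> M \<rightarrow>\<^sub>M ?Q"
    by (auto intro!: measurable_PiM_single' simp: space_PiM)
  \<comment> \<open>The gaps are a measurable function of the arrival times, hence events about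
    \<open>E\<close> lie in the sigma-algebra generated by \<open>T\<close>, to which the
    independence hypothesis refers.\<close>
  define increments :: "(nat \<Rightarrow> real) \<Rightarrow> nat \<Rightarrow> real"
    where "increments t n = (case n of 0 \<Rightarrow> t 0 | Suc m \<Rightarrow> t (Suc m) - t m)" for t n
  have increments [measurable]: "increments \<in> ?P \<rightarrow>\<^sub>M ?P"
    by (rule measurable_PiM_single') (auto simp: increments_def space_PiM split: nat.split)
  have E_eq: "increments (\<lambda>i. T i \<omega>) = (\<lambda>i. E i \<omega>)" for \<omega>
    by (auto simp: fun_eq_iff increments_def assms(8) split: nat.split)
  have "distr M (?P \<Otimes>\<^sub>M ?Q) (\<lambda>\<omega>. (\<lambda>i. E i \<omega>, \<lambda>i. \<Delta> i \<omega>)) =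
      distr M ?P (\<lambda>\<omega> i. E i \<omega>) \<Otimes>\<^sub>M distr M ?Q (\<lambda>\<omega> i. \<Delta> i \<omega>)"
  proof (rule distr_pair_indep_set[OF assms(9) rv(1,3)])
    fix A assume A: "A \<in> sets ?P"
    have "(\<lambda>\<omega> i. T i \<omega>) -` (increments -` A \<inter> space ?P) \<inter> space M
        \<in> sets (vimage_algebra (space M) (\<lambda>\<omega> i. T i \<omega>) ?P)"
      by (intro in_vimage_algebra measurable_sets[OF increments A])
    then show "(\<lambda>\<omega> i. E i \<omega>) -` A \<inter> space M \<in> sets (vimage_algebra (space M) (\<lambda>\<omega> i. T i \<omega>) ?P)"
      by (simp add: vimage_def E_eq space_PiM)
  qed (rule in_vimage_algebra)
  then have joint: "distr M (?P \<Otimes>\<^sub>M ?Q) (\<lambda>\<omega>. (\<lambda>i. E i \<omega>, \<lambda>i. \<Delta> i \<omega>)) =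
      PiM UNIV (\<lambda>_. N) \<Otimes>\<^sub>M PiM UNIV (\<lambda>_. \<sigma>)"
    by (simp add: seq_law[OF assms(6) distr_E] seq_law[OF assms(2,3)])

  \<comment> \<open>Needed to replace \<open>h0\<close> by \<open>h\<close> along the
    arrivals.\<close>
  have T_nonneg: "AE \<omega> in M. \<forall>i. 0 \<le> T i \<omega>"
  proof -
    have "AE x in N. 0 \<le> x"
      unfolding N_def by (subst AE_density) (auto simp: exponential_density_def intro!: AE_I2)
    then have "AE \<omega> in M. 0 \<le> E i \<omega>" for i
      unfolding distr_E[of i, symmetric] by (rule AE_distrD[rotated]) simp
    then have "AE \<omega> in M. \<forall>i. 0 \<le> E i \<omega>" by (simp add: AE_all_countable)
    then show ?thesis by (auto elim!: eventually_mono simp: assms(8) intro!: sum_nonneg)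
  qed

  have h0 [measurable]: "h0 \<in> borel_measurable (borel \<Otimes>\<^sub>M borel)"
  proof -
    let ?H = "restrict_space (borel \<Otimes>\<^sub>M borel) {z :: real \<times> (real ^ 'd). fst z \<in> {0..}}"
    have "(\<lambda>z. (fst z, snd z)) \<in> ?H \<rightarrow>\<^sub>M restrict_space borel {0..} \<Otimes>\<^sub>M borel"
      by (intro measurable_Pair measurable_restrict_space2 measurable_restrict_space1)
        (auto simp: space_restrict_space)
    from measurable_compose[OF this assms(10)] have "h \<in> borel_measurable ?H" by simp
    then show ?thesis
      unfolding h0_def by (subst measurable_If_restrict_space_iff) simp_all
  qed

  have null: "AE t in lborel. AE x in \<sigma>. h0 (t, x) \<notin> C" if C: "C \<in> null_sets lborel" "0 \<notin> C" for C
  proof -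
    let ?R = "restrict_space lborel {0..} \<Otimes>\<^sub>M \<sigma>"
    interpret half_line: sigma_finite_measure "restrict_space lborel {0::real..}"
      by (intro sigma_finite_measure_restrict_space sigma_finite_lborel) simp
    interpret R: pair_sigma_finite "restrict_space lborel {0::real..}" \<sigma> ..
    have R: "(borel_measurable ?R :: (_ \<Rightarrow> real) set) =
        borel_measurable (restrict_space borel {0..} \<Otimes>\<^sub>M borel)"
      by (intro measurable_cong_sets sets_pair_measure_cong sets_restrict_space_cong)
        (simp_all add: \<sigma>(2))
    have h: "h \<in> borel_measurable ?R"
      unfolding R by (rule assms(10))
    have "C \<in> null_sets (restrict_space (distr ?R borel h) (- {0}))"
      using assms(13) C unfolding absolutely_continuous_def by (auto simp: null_sets_restrict_space)
    then have "AE y in distr ?R borel h. y \<notin> C"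
      by (intro AE_not_in) (simp add: null_sets_restrict_space)
    then have "AE z in ?R. h z \<notin> C"
      by (rule AE_distrD[OF h])
    \<comment> \<open>Fubini turns the null preimage of \<open>C\<close> into a statement about
      almost every time; at negative times \<open>h0\<close> equals \<open>0\<close>, which is not
      in \<open>C\<close>.\<close>
    then have "AE t in restrict_space lborel {0..}. AE x in \<sigma>. h (t, x) \<notin> C"
      by (rule R.AE_pair)
    then show ?thesis
      using C(2) by (subst (asm) AE_restrict_space_iff) (auto simp: h0_def elim!: eventually_mono)
  qed

  have ac: "AE \<omega> in M. I \<omega> \<notin> A" if A: "A \<in> null_sets lborel" "0 \<notin> A" for A
  proof -
    have "AE \<omega> in M. \<not> hits h0 A i (\<lambda>i. E i \<omega>) (\<lambda>i. \<Delta> i \<omega>)" for i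
    proof -
      have "AE z in distr M (?P \<Otimes>\<^sub>M ?Q) (\<lambda>\<omega>. (\<lambda>i. E i \<omega>, \<lambda>i. \<Delta> i \<omega>)). \<not> hits h0 A i (fst z) (snd z)"
        using AE_not_hits[OF h0 \<sigma> _ N[unfolded N_def] null A(1), of i]
        unfolding joint N_def by (simp add: split_beta)
      from AE_distrD[OF measurable_Pair[OF rv(1,3)] this] show ?thesis by simp
    qed
    then have "AE \<omega> in M. \<forall>i. \<not> hits h0 A i (\<lambda>i. E i \<omega>) (\<lambda>i. \<Delta> i \<omega>)"
      by (simp add: AE_all_countable)
    with assms(12) T_nonneg show ?thesis
    proof eventually_elim
      case (elim \<omega>)
      have shot: "shot h0 (\<lambda>i. E i \<omega>) (\<lambda>i. \<Delta> i \<omega>) = (\<lambda>i. h (T i \<omega>, \<Delta> i \<omega>))"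
        using elim(2) by (auto simp: fun_eq_iff shot_def h0_def assms(8))
      show ?case
      proof
        assume "I \<omega> \<in> A"
        \<comment> \<open>The series converges to a point of \<open>A\<close>, so the absence of
          every bad event leaves only zero terms.\<close>
        with elim(1,3) have "\<forall>i. h (T i \<omega>, \<Delta> i \<omega>) = 0"
          by (auto simp: hits_def shot dest: sums_summable sums_unique)
        with elim(1) have "I \<omega> = 0" by (simp add: sums_iff)
        with \<open>I \<omega> \<in> A\<close> A(2) show False by simp
      qed
    qed
  qed
  show ?thesis
  proof (intro conjI ballI impI)
    show "absolutely_continuous (restrict_space lborel (- {0})) (restrict_space (distr M borel I) (- {0}))"
      unfolding absolutely_continuous_def
    proof
      fix A assume "A \<in> null_sets (restrict_space lborel (- {0::real}))"
      then have A: "A \<subseteq> - {0}" "A \<in> null_sets lborel" by (auto simp: null_sets_restrict_space)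
      then have "AE \<omega> in M. I \<omega> \<notin> A" by (intro ac) auto
      then have "AE x in distr M borel I. x \<notin> A"
        using assms(11) A by (subst AE_distr_iff) auto
      moreover have "A \<in> sets (distr M borel I)" using A by auto
      ultimately have "A \<in> null_sets (distr M borel I)" by (simp only: AE_iff_null_sets)
      with A show "A \<in> null_sets (restrict_space (distr M borel I) (- {0}))"
        by (simp add: null_sets_restrict_space)
    qed
  next
    fix A :: "real set" assume "A \<in> sets borel" "A \<subseteq> - {0}" "emeasure lborel A = 0"
    then have "AE \<omega> in M. I \<omega> \<notin> A" by (intro ac) auto
    then show "measure M {\<omega> \<in> space M. I \<omega> \<in> A} = 0"
      by (intro prob_eq_0_AE)
  qed
qed

end
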